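(* The foil conductor model $$M_\sigma\tfrac{\mathrm d}{\mathrm dt}a+K_\nu a-X_{\mathrm{foil}}\,\mathbf e=0,\qquad -X_{\mathrm{foil}}^\top\tfrac{\mathrm d}{\mathrm dt}a+G_{\mathrm{foil}}\,\mathbf e-c\,\imath_{\mathrm{foil}}=0,\qquad -c^\top\mathbf e+v_{\mathrm{foil}}=0,$$ with $G_{\mathrm{foil}}=X_{\mathrm{foil}}^\top M_\sigma^{+}X_{\mathrm{foil}}$, unknowns $a\colon[t_0,t_{\mathrm f}]\to\mathbb R^{n_w}$, $\mathbf e\colon[t_0,t_{\mathrm f}]\to\mathbb R^{n_p}$, $\imath_{\mathrm{foil}}\colon[t_0,t_{\mathrm f}]\to\mathbb R$ and input $v_{\mathrm{foil}}\colon[t_0,t_{\mathrm f}]\to\mathbb R$, fits into the structure $$\begin{bmatrix}\nabla_{z_1}\mathcal H(z_1,z_2)\\ \frac{\mathrm d}{\mathrm dt}z_2\\ 0\end{bmatrix}=(\mathcal J-\mathcal R)\begin{bmatrix}\frac{\mathrm d}{\mathrm dt}z_1\\ \nabla_{z_2}\mathcal H(z_1,z_2)\\ z_3\end{bmatrix}+\mathcal B u$$ with $\mathcal J=-\mathcal J^\top$ and $\mathcal R=\mathcal R^\top$ positive semi-definite.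
   Context: "Fits into the structure" means: the unknowns of the model can be grouped into components $z_1,z_2,z_3$ (any of which may be absent) and, with $u$ the input of the model, there exist a function $\mathcal H\in C^1$ of $(z_1,z_2)$ and real constant matrices $\mathcal J=-\mathcal J^\top$, $\mathcal R=\mathcal R^\top\ge0$, $\mathcal B$ of appropriate sizes such that the model equations are equivalent to the displayed structured system. Matrices of the model. $\Omega\subset\mathbb R^3$ is a simply connected Lipschitz domain; $w_1,\dots,w_{n_w}$ are (vector-valued, edge-element) finite element basis functions on $\Omega$, lying in $H(\mathrm{curl};\Omega)$ with vanishing tangential trace; $\nu>0$ is a constant (reluctivity); the conductivity $\sigma$ equals a constant $\sigma_{\mathrm c}>0$ on a subdomain $\Omega_{\mathrm c}\subset\Omega$ and $0$ elsewhere. Then $$[M_\sigma]_{ij}=\int_\Omega\sigma\,w_j\cdot w_i\,\mathrm dV,\qquad [K_\nu]_{ij}=\int_\Omega\nu\,(\nabla\times w_j)\cdot(\nabla\times w_i)\,\mathrm dV ,$$ and $M_\sigma^{+}$ is the Moore–Penrose pseudo-inverse of $M_\sigma$. It is assumed that (after gauging) the pencil $\lambda M_\sigma+K_\nu$ is regular. The foil conductor domain $\Omega_{\mathrm{foil}}$ is a subdomain of $\Omega_{\mathrm c}$. The scalar functions $p_1,\dots,p_{n_p}$ are finite element basis functions for a voltage function $\Phi$, and $x=[x_1,\dots,x_{n_w}]^\top$ is the coordinate vector, with respect to $(w_i)$, of a given distribution function $\chi_{\mathrm{sol}}$. The matrix $X_{\mathrm{foil}}\in\mathbb R^{n_w\times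 n_p}$ and vector $c\in\mathbb R^{n_p}$ are $$[X_{\mathrm{foil}}]_{i\ell}=\sum_{j=1}^{n_w}x_j\int_\Omega\sigma\,p_\ell\,w_j\cdot w_i\,\mathrm dV,\qquad [c]_k=\frac1b\int_{\Lambda}p_k\,\mathrm ds,$$ where $b>0$ is the thickness of a foil and $\Lambda$ is a fixed one-dimensional curve (crossing the foils in thickness direction; the one-dimensional domain of homogenization); all integrals are assumed to be well defined. *)

theory Defs
  imports "HOL-Analysis.Analysis"
begin

section \<open>Domains and function spaces\<close>

text \<open>Locally, after a rotation that makes \<open>n\<close> the last coordinate direction, the domain is
  the strict epigraph of a Lipschitz function \<open>g\<close> of the remaining coordinates
  \<open>x - (x \<bullet> n) n\<close>. As \<open>U\<close> is open and \<open>g\<close> continuous, the boundary within \<open>U\<close> is then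
  the graph of \<open>g\<close>.\<close>

definition lipschitz_boundary :: "'a::euclidean_space set \<Rightarrow> bool" where
  "lipschitz_boundary \<Omega> \<longleftrightarrow>
    (\<forall>x0 \<in> frontier \<Omega>. \<exists>U n L. \<exists>g :: 'a \<Rightarrow> real.
       open U \<and> x0 \<in> U \<and> norm n = 1 \<and> L-lipschitz_on UNIV g \<and>
       \<Omega> \<inter> U = {x \<in> U. g (x - (x \<bullet> n) *\<^sub>R n) < x \<bullet> n})"

definition lipschitz_domain :: "'a::euclidean_space set \<Rightarrow> bool" where
  "lipschitz_domain \<Omega> \<longleftrightarrow>
     open \<Omega> \<and> connected \<Omega> \<and> \<Omega> \<noteq> {} \<and> bounded \<Omega> \<and> lipschitz_boundary \<Omega>"

definition partial_deriv :: "'n::finite \<Rightarrow> (real^'n \<Rightarrow> 'b::real_normed_vector) \<Rightarrow> real^'n \<Rightarrow> 'b" where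
  "partial_deriv j f x = frechet_derivative f (at x) (axis j 1)"

primrec Ck :: "nat \<Rightarrow> (real^'n::finite \<Rightarrow> 'b::real_normed_vector) \<Rightarrow> bool" where
  "Ck 0 f \<longleftrightarrow> continuous_on UNIV f"
| "Ck (Suc k) f \<longleftrightarrow> (\<forall>x. f differentiable (at x)) \<and> (\<forall>j. Ck k (partial_deriv j f))"

definition smooth :: "(real^'n::finite \<Rightarrow> 'b::real_normed_vector) \<Rightarrow> bool" where
  "smooth f \<longleftrightarrow> (\<forall>k. Ck k f)"

definition curl :: "(real^3 \<Rightarrow> real^3) \<Rightarrow> real^3 \<Rightarrow> real^3" where
  "curl f x = vector
     [partial_deriv 2 f x $ 3 - partial_deriv 3 f x $ 2,
      partial_deriv 3 f x $ 1 - partial_deriv 1 f x $ 3,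
      partial_deriv 1 f x $ 2 - partial_deriv 2 f x $ 1]"

definition test_function :: "(real^'n::finite) set \<Rightarrow> (real^'n \<Rightarrow> 'b::real_normed_vector) \<Rightarrow> bool" where
  "test_function \<Omega> \<phi> \<longleftrightarrow>
     smooth \<phi> \<and> compact (closure {x. \<phi> x \<noteq> 0}) \<and> closure {x. \<phi> x \<noteq> 0} \<subseteq> \<Omega>"

definition square_integrable :: "'a::euclidean_space set \<Rightarrow> ('a \<Rightarrow> 'b::euclidean_space) \<Rightarrow> bool" where
  "square_integrable \<Omega> f \<longleftrightarrow>
     f \<in> borel_measurable (lebesgue_on \<Omega>) \<and> integrable (lebesgue_on \<Omega>) (\<lambda>x. (norm (f x))\<^sup>2)"

definition has_weak_curl :: "(real^3) set \<Rightarrow> (real^3 \<Rightarrow> real^3) \<Rightarrow> (real^3 \<Rightarrow> real^3) \<Rightarrow> bool" where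
  "has_weak_curl \<Omega> f g \<longleftrightarrow> square_integrable \<Omega> g \<and>
     (\<forall>\<phi>. test_function \<Omega> \<phi> \<longrightarrow>
        (LINT x|lebesgue_on \<Omega>. f x \<bullet> curl \<phi> x) = (LINT x|lebesgue_on \<Omega>. g x \<bullet> \<phi> x))"

definition Hcurl :: "(real^3) set \<Rightarrow> (real^3 \<Rightarrow> real^3) set" where
  "Hcurl \<Omega> = {f. square_integrable \<Omega> f \<and> (\<exists>g. has_weak_curl \<Omega> f g)}"

text \<open>A representative; for elements of \<open>Hcurl \<Omega>\<close> it is unique almost everywhere in \<open>\<Omega>\<close>.\<close>

definition weak_curl :: "(real^3) set \<Rightarrow> (real^3 \<Rightarrow> real^3) \<Rightarrow> real^3 \<Rightarrow> real^3" where
  "weak_curl \<Omega> f = (SOME g. has_weak_curl \<Omega> f g)"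

text \<open>The tangential trace of \<open>f \<in> Hcurl \<Omega>\<close> is the functional that Green's formula assigns to
  it on the boundary, tested with functions that are smooth up to the boundary (bounded
  \<open>\<Omega>\<close>).\<close>

definition tangential_trace :: "(real^3) set \<Rightarrow> (real^3 \<Rightarrow> real^3) \<Rightarrow> (real^3 \<Rightarrow> real^3) \<Rightarrow> real" where
  "tangential_trace \<Omega> f \<phi> =
     (LINT x|lebesgue_on \<Omega>. weak_curl \<Omega> f x \<bullet> \<phi> x) - (LINT x|lebesgue_on \<Omega>. f x \<bullet> curl \<phi> x)"

definition vanishing_tangential_trace :: "(real^3) set \<Rightarrow> (real^3 \<Rightarrow> real^3) \<Rightarrow> bool" where
  "vanishing_tangential_trace \<Omega> f \<longleftrightarrow> (\<forall>\<phi>. smooth \<phi> \<longrightarrow> tangential_trace \<Omega> f \<phi> = 0)"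

definition lin_indep_family ::
    "'a::euclidean_space set \<Rightarrow> ('i::finite \<Rightarrow> 'a \<Rightarrow> 'b::real_vector) \<Rightarrow> bool" where
  "lin_indep_family \<Omega> f \<longleftrightarrow>
     (\<forall>k :: 'i \<Rightarrow> real. (AE x in lebesgue_on \<Omega>. (\<Sum>i\<in>UNIV. k i *\<^sub>R f i x) = 0) \<longrightarrow> (\<forall>i. k i = 0))"


section \<open>Matrices\<close>

definition is_moore_penrose :: "real^'n^'m \<Rightarrow> real^'m^'n \<Rightarrow> bool" where
  "is_moore_penrose A P \<longleftrightarrow>
     A ** P ** A = A \<and> P ** A ** P = P \<and>
     transpose (A ** P) = A ** P \<and> transpose (P ** A) = P ** A"

definition moore_penrose :: "real^'n^'m \<Rightarrow> real^'m^'n" where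
  "moore_penrose A = (THE P. is_moore_penrose A P)"

definition regular_pencil :: "real^'n^'n \<Rightarrow> real^'n^'n \<Rightarrow> bool" where
  "regular_pencil A B \<longleftrightarrow>
     (\<exists>s::complex. det (\<chi> i j. s * complex_of_real (A $ i $ j) + complex_of_real (B $ i $ j)) \<noteq> 0)"

definition pos_semidef :: "real^'n^'n \<Rightarrow> bool" where
  "pos_semidef A \<longleftrightarrow> (\<forall>y. 0 \<le> y \<bullet> (A *v y))"

definition conductivity :: "(real^3) set \<Rightarrow> real \<Rightarrow> real^3 \<Rightarrow> real" where
  "conductivity \<Omega>c \<sigma>c r = (if r \<in> \<Omega>c then \<sigma>c else 0)"

definition mass_matrix ::
    "(real^3) set \<Rightarrow> (real^3 \<Rightarrow> real) \<Rightarrow> ('nw \<Rightarrow> real^3 \<Rightarrow> real^3) \<Rightarrow> real^'nw^'nw::finite" where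
  "mass_matrix \<Omega> \<sigma> w = (\<chi> i j. LINT r|lebesgue_on \<Omega>. \<sigma> r * (w j r \<bullet> w i r))"

definition stiffness_matrix ::
    "(real^3) set \<Rightarrow> real \<Rightarrow> ('nw \<Rightarrow> real^3 \<Rightarrow> real^3) \<Rightarrow> real^'nw^'nw::finite" where
  "stiffness_matrix \<Omega> \<nu> w =
     (\<chi> i j. LINT r|lebesgue_on \<Omega>. \<nu> * (weak_curl \<Omega> (w j) r \<bullet> weak_curl \<Omega> (w i) r))"

definition foil_matrix ::
    "(real^3) set \<Rightarrow> (real^3 \<Rightarrow> real) \<Rightarrow> ('nw \<Rightarrow> real^3 \<Rightarrow> real^3) \<Rightarrow> ('np \<Rightarrow> real^3 \<Rightarrow> real)
      \<Rightarrow> real^'nw \<Rightarrow> real^'np^'nw::finite" where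
  "foil_matrix \<Omega> \<sigma> w p x =
     (\<chi> i l. \<Sum>j\<in>UNIV. x $ j * (LINT r|lebesgue_on \<Omega>. \<sigma> r * p l r * (w j r \<bullet> w i r)))"

text \<open>The curve is given by a parametrisation \<open>\<Lambda>\<close>; the integral is with respect to arc length.\<close>

definition foil_vector ::
    "real \<Rightarrow> (real \<Rightarrow> real^3) \<Rightarrow> ('np \<Rightarrow> real^3 \<Rightarrow> real) \<Rightarrow> real^'np" where
  "foil_vector b \<Lambda> p =
     (\<chi> k. (1 / b) *
        (LINT s|lebesgue_on {0..1}. p k (\<Lambda> s) * norm (vector_derivative \<Lambda> (at s))))"


section \<open>The structured system\<close>

text \<open>The scalar unknowns, indexed by \<open>'k\<close>, are collected in one vector \<open>z\<close>, and
  \<open>\<gamma>\<close> tells to which of the components \<open>z\<^sub>1\<close>, \<open>z\<^sub>2\<close>, \<open>z\<^sub>3\<close> an entry belongs; a component to which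
  no entry is assigned is absent. The block rows and block columns of the system are thus
  interleaved according to \<open>\<gamma>\<close>. Only entries of \<open>z\<^sub>1\<close> and \<open>z\<^sub>2\<close> have to be differentiable,
  and entries of \<open>dz\<close> belonging to \<open>z\<^sub>3\<close> are never used. At the end points of the time
  interval derivatives are one-sided.\<close>

datatype component = Z1 | Z2 | Z3

definition structured_system ::
    "real \<Rightarrow> real \<Rightarrow> ('k::finite \<Rightarrow> component) \<Rightarrow> (real^'k \<Rightarrow> real^'k) \<Rightarrow>
     real^'k^'k \<Rightarrow> real^'k^'k \<Rightarrow> real^'m^'k \<Rightarrow> (real \<Rightarrow> real^'k) \<Rightarrow> (real \<Rightarrow> real^'m) \<Rightarrow> bool" where
  "structured_system t0 tf \<gamma> gradH J R B z u \<longleftrightarrow>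
     (\<exists>dz :: real \<Rightarrow> real^'k. \<forall>t\<in>{t0..tf}.
        (\<forall>i. \<gamma> i \<noteq> Z3 \<longrightarrow>
           ((\<lambda>s. z s $ i) has_real_derivative dz t $ i) (at t within {t0..tf})) \<and>
        (\<chi> i. case \<gamma> i of Z1 \<Rightarrow> gradH (z t) $ i | Z2 \<Rightarrow> dz t $ i | Z3 \<Rightarrow> 0) =
          (J - R) *v (\<chi> i. case \<gamma> i of Z1 \<Rightarrow> dz t $ i | Z2 \<Rightarrow> gradH (z t) $ i | Z3 \<Rightarrow> z t $ i)
          + B *v u t)"

text \<open>A model is given by its set of solutions \<open>(z, u)\<close>, with \<open>unknown\<close> telling to which of
  the unknowns of the model a scalar entry of \<open>z\<close> belongs. The grouping assigns each unknown
  as a whole to one of the components. The third condition says that \<open>H\<close> is a function of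
  \<open>z\<^sub>1\<close> and \<open>z\<^sub>2\<close> only.\<close>

definition fits_structure ::
    "real \<Rightarrow> real \<Rightarrow> ('k::finite \<Rightarrow> 'u) \<Rightarrow>
     ((real \<Rightarrow> real^'k) \<Rightarrow> (real \<Rightarrow> real^'m) \<Rightarrow> bool) \<Rightarrow> bool" where
  "fits_structure t0 tf unknown model \<longleftrightarrow>
     (\<exists>(group :: 'u \<Rightarrow> component) (H :: real^'k \<Rightarrow> real) gradH
        (J :: real^'k^'k) (R :: real^'k^'k) (B :: real^'m^'k).
        (\<forall>z. GDERIV H z :> gradH z) \<and> continuous_on UNIV gradH \<and>
        (\<forall>z z'. (\<forall>i. group (unknown i) \<noteq> Z3 \<longrightarrow> z $ i = z' $ i) \<longrightarrow> H z = H z') \<and>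
        J = - transpose J \<and> R = transpose R \<and> pos_semidef R \<and>
        (\<forall>z u. model z u \<longleftrightarrow> structured_system t0 tf (\<lambda>i. group (unknown i)) gradH J R B z u))"


section \<open>The foil conductor model\<close>

definition foil_conductor_model ::
    "real \<Rightarrow> real \<Rightarrow> real^'nw^'nw \<Rightarrow> real^'nw^'nw \<Rightarrow> real^'np^'nw \<Rightarrow> real^'np^'np \<Rightarrow> real^'np \<Rightarrow>
     (real \<Rightarrow> real^'nw) \<Rightarrow> (real \<Rightarrow> real^'np) \<Rightarrow> (real \<Rightarrow> real) \<Rightarrow> (real \<Rightarrow> real) \<Rightarrow> bool" where
  "foil_conductor_model t0 tf M K X G c a e \<iota> v \<longleftrightarrow>
     (\<exists>da :: real \<Rightarrow> real^'nw. \<forall>t\<in>{t0..tf}.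
        (a has_vector_derivative da t) (at t within {t0..tf}) \<and>
        M *v da t + K *v a t - X *v e t = 0 \<and>
        - (transpose X *v da t) + G *v e t - \<iota> t *\<^sub>R c = 0 \<and>
        - (c \<bullet> e t) + v t = 0)"

datatype foil_unknown = Unknown_a | Unknown_e | Unknown_i

primrec foil_rest_unknown :: "'np + unit \<Rightarrow> foil_unknown" where
  "foil_rest_unknown (Inl k) = Unknown_e"
| "foil_rest_unknown (Inr q) = Unknown_i"

primrec foil_unknown_of :: "'nw + 'np + unit \<Rightarrow> foil_unknown" where
  "foil_unknown_of (Inl i) = Unknown_a"
| "foil_unknown_of (Inr r) = foil_rest_unknown r"

definition a_part :: "real^('nw::finite + 'np::finite + unit) \<Rightarrow> real^'nw" where
  "a_part z = (\<chi> i. z $ Inl i)"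

definition e_part :: "real^('nw::finite + 'np::finite + unit) \<Rightarrow> real^'np" where
  "e_part z = (\<chi> k. z $ Inr (Inl k))"

definition i_part :: "real^('nw::finite + 'np::finite + unit) \<Rightarrow> real" where
  "i_part z = z $ Inr (Inr ())"

end

theory Submission
  imports Defs
begin

text \<open>Take \<open>z\<^sub>1 = a\<close>, no \<open>z\<^sub>2\<close>, \<open>z\<^sub>3 = (e, \<iota>)\<close> and \<open>H = a\<^sup>T K a / 2\<close>. The model then reads
  \<open>(K a, 0, 0) = A (a', e, \<iota>) + B v\<close> with \<open>A = J - R\<close> split into its skew and symmetric parts, and
  it remains to see that the quadratic form of \<open>A\<close> is nonpositive. Every column of \<open>X\<close> is orthogonal
  to the kernel of the symmetric matrix \<open>M\<close>, so \<open>X = M Y\<close> for some \<open>Y\<close>, whence \<open>G = Y\<^sup>T M Y\<close> and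
  \<open>R\<close> has the quadratic form \<open>(a - Y e)\<^sup>T M (a - Y e) \<ge> 0\<close>.\<close>

section \<open>Solvability of linear systems and factorisation of matrices\<close>

text \<open>Fredholm alternative. The component \<open>z\<close> of \<open>b\<close> orthogonal to
  the range lies in the kernel of the transpose, so it is orthogonal to \<open>b\<close> and hence
  to itself.\<close>

lemma matrix_image_iff_orthogonal_kernel:
  fixes A :: "real^'n^'m"
  shows "(\<exists>x. A *v x = b) \<longleftrightarrow> (\<forall>y. transpose A *v y = 0 \<longrightarrow> y \<bullet> b = 0)"
proof
  assume "\<exists>x. A *v x = b"
  then show "\<forall>y. transpose A *v y = 0 \<longrightarrow> y \<bullet> b = 0"
    by (auto simp: dot_lmul_matrix[symmetric])
next
  assume orth: "\<forall>y. transpose A *v y = 0 \<longrightarrow> y \<bullet> b = 0"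
  obtain y z where y: "y \<in> span (range ((*v) A))"
    and z: "\<And>u. u \<in> span (range ((*v) A)) \<Longrightarrow> orthogonal z u" and b: "b = y + z"
    using orthogonal_subspace_decomp_exists by blast
  have "subspace (range ((*v) A))"
    by (rule linear_subspace_image) auto
  then obtain x where x: "y = A *v x"
    using y by (auto simp: span_eq_iff[THEN iffD2])
  have "(transpose A *v z) \<bullet> u = 0" for u
    using z[of "A *v u"] by (simp add: span_base orthogonal_def dot_lmul_matrix)
  then have "transpose A *v z = 0"
    using inner_eq_zero_iff by blast
  then have "z \<bullet> b = 0"
    using orth by blast
  moreover have "z \<bullet> y = 0"
    using z[OF y] by (simp add: orthogonal_def)
  ultimately have "z = 0"
    by (simp add: b inner_right_distrib)
  then show "\<exists>x. A *v x = b"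
    using b x by auto
qed

text \<open>Each column of \<open>B\<close> is in the range of \<open>A\<close>; the chosen
  preimages form the columns of \<open>Y\<close>.\<close>

lemma matrix_factor_through:
  fixes A :: "real^'n^'m" and B :: "real^'k^'m"
  assumes "\<And>y l. transpose A *v y = 0 \<Longrightarrow> y \<bullet> column l B = 0"
  obtains Y where "B = A ** Y"
proof -
  have "\<forall>l. \<exists>x. A *v x = column l B"
    using assms by (simp add: matrix_image_iff_orthogonal_kernel)
  then obtain f where f: "\<And>l. A *v f l = column l B"
    by metis
  have "B = A ** (\<chi> i l. f l $ i)"
    using f by (simp add: vec_eq_iff matrix_matrix_mult_def matrix_vector_mult_def column_def)
  then show thesis
    by (rule that)
qed

section \<open>The Moore-Penrose pseudo-inverse of a symmetric matrix\<close>

text \<open>Both \<open>A ** P\<close> and \<open>A ** Q\<close> are the orthogonal projection onto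
  the range of \<open>A\<close>, and \<open>P ** A\<close>, \<open>Q ** A\<close> agree in the same
  way. Then \<open>P = P A P = P A Q = Q A Q = Q\<close>.\<close>

lemma is_moore_penrose_unique:
  assumes P: "is_moore_penrose A P" and Q: "is_moore_penrose A Q"
  shows "P = Q"
proof -
  note p = P[unfolded is_moore_penrose_def] and q = Q[unfolded is_moore_penrose_def]
  have "A ** P = transpose (A ** P)"
    using p by simp
  also have "\<dots> = transpose ((A ** Q) ** (A ** P))"
    using q by (simp add: matrix_mul_assoc)
  also have "\<dots> = (A ** P) ** (A ** Q)"
    using p q by (simp add: matrix_transpose_mul)
  also have "\<dots> = A ** Q"
    using p by (simp add: matrix_mul_assoc)
  finally have AP: "A ** P = A ** Q" .
  have "P ** A = transpose (P ** A)"
    using p by simp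
  also have "\<dots> = transpose ((P ** A) ** (Q ** A))"
    using q by (metis matrix_mul_assoc)
  also have "\<dots> = (Q ** A) ** (P ** A)"
    using p q by (simp add: matrix_transpose_mul)
  also have "\<dots> = Q ** A"
    using p by (metis matrix_mul_assoc)
  finally have PA: "P ** A = Q ** A" .
  show ?thesis
    using p q AP PA by (metis matrix_mul_assoc)
qed

text \<open>A symmetric \<open>M\<close> has the same kernel, hence the same range, as \<open>M\<^sup>2\<close>, so \<open>M = M\<^sup>2 Y\<close> for
  some \<open>Y\<close>; then \<open>E = M Y\<close> is the orthogonal projection onto the range of \<open>M\<close> and
  \<open>Y\<^sup>T M Y\<close> is the pseudo-inverse.\<close>

lemma symmetric_has_moore_penrose:
  fixes M :: "real^'n^'n"
  assumes sym: "transpose M = M"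
  shows "\<exists>P. is_moore_penrose M P"
proof -
  have ker: "M *v y = 0" if "M *v (M *v y) = 0" for y
  proof -
    have "(M *v y) \<bullet> (M *v y) = (y v* M) \<bullet> (M *v y)"
      by (metis sym transpose_matrix_vector)
    also have "\<dots> = y \<bullet> (M *v (M *v y))"
      by (rule dot_lmul_matrix)
    finally show ?thesis
      using that by simp
  qed
  have "y \<bullet> column l M = 0" if "transpose (M ** M) *v y = 0" for y l
  proof -
    have "M *v y = 0"
      using that ker unfolding matrix_transpose_mul sym by (simp add: matrix_vector_mul_assoc)
    moreover have "y \<bullet> column l M = (transpose M *v y) $ l"
      by (simp add: inner_vec_def column_def matrix_vector_mult_def transpose_def mult.commute
          del: transpose_matrix_vector)
    ultimately show ?thesis
      by (simp add: sym del: transpose_matrix_vector)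
  qed
  then obtain Y where Y: "M = (M ** M) ** Y"
    using matrix_factor_through[of "M ** M" M] by metis
  define E where "E = M ** Y"
  have ME: "M ** E = M"
    using Y by (simp add: E_def matrix_mul_assoc)
  have E': "transpose E = transpose Y ** M"
    by (simp add: E_def matrix_transpose_mul sym)
  have "transpose E ** M = M"
    using ME by (metis matrix_transpose_mul sym)
  \<comment> \<open>Multiplication by \<open>Y\<close> on the right. The left side is symmetric,
    hence so is \<open>E\<close>.\<close>
  then have "transpose E ** E = E"
    by (simp add: E_def matrix_mul_assoc)
  then have Esym: "transpose E = E"
    by (metis matrix_transpose_mul transpose_transpose)
  then have EM: "E ** M = M"
    using \<open>transpose E ** M = M\<close> by simp
  have EE: "E ** E = E"
    using Esym \<open>transpose E ** E = E\<close> by simp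
  \<comment> \<open>This is \<open>transpose Y ** M ** Y\<close>, because
    \<open>E = transpose E = transpose Y ** M\<close>.\<close>
  define P where "P = E ** Y"
  have MP: "M ** P = E"
    by (simp add: P_def matrix_mul_assoc ME E_def[symmetric])
  have "P = transpose Y ** E"
    unfolding P_def by (metis E' Esym E_def matrix_mul_assoc)
  then have PM: "P ** M = E"
    by (metis E' Esym EM matrix_mul_assoc)
  have "is_moore_penrose M P"
    unfolding is_moore_penrose_def
    by (simp add: MP PM EM Esym) (simp add: P_def matrix_mul_assoc EE)
  then show ?thesis ..
qed

lemma moore_penrose_symmetric:
  fixes M :: "real^'n^'n"
  assumes "transpose M = M"
  shows "is_moore_penrose M (moore_penrose M)"
  unfolding moore_penrose_def
  by (rule theI') (use symmetric_has_moore_penrose[OF assms] is_moore_penrose_unique in blast)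

section \<open>Quadratic forms, entrywise derivatives and block vectors\<close>

lemma inner_transpose_mult_self:
  fixes A :: "real^'n^'n"
  shows "y \<bullet> (transpose A *v y) = y \<bullet> (A *v y)"
  by (metis dot_lmul_matrix inner_commute transpose_matrix_vector)

lemma symmetric_inner_commute:
  fixes M :: "real^'n^'n"
  assumes "transpose M = M"
  shows "x \<bullet> (M *v y) = y \<bullet> (M *v x)"
  by (metis assms dot_lmul_matrix inner_commute transpose_matrix_vector)

text \<open>Mediates between the model, which differentiates the vector \<open>a\<close>, and the
  structured system, which differentiates single entries.\<close>

lemma has_vector_derivative_vec_iff:
  fixes f :: "real \<Rightarrow> real^'n"
  shows "(f has_vector_derivative f') (at t within S) \<longleftrightarrow>
    (\<forall>i. ((\<lambda>s. f s $ i) has_real_derivative f' $ i) (at t within S))"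
proof -
  have "(\<lambda>x. x * d) = (*) d" for d :: real
    by (rule ext) (rule mult.commute)
  then show ?thesis
    unfolding has_vector_derivative_def has_field_derivative_def
    by (subst has_derivative_componentwise_within) (simp add: Basis_vec_def inner_axis)
qed

text \<open>The block matrices \<open>A\<close> and \<open>B\<close> below are given as linear maps
  with values of this form, so that no matrix entries have to be handled.\<close>

definition foil_vec :: "real^'nw \<Rightarrow> real^'np \<Rightarrow> real \<Rightarrow> real^('nw::finite + 'np::finite + unit)" where
  "foil_vec a e i = (\<chi> k. case k of Inl j \<Rightarrow> a $ j | Inr (Inl l) \<Rightarrow> e $ l | Inr (Inr q) \<Rightarrow> i)"

lemma foil_vec_nth [simp]:
  "foil_vec a e i $ Inl j = a $ j"
  "foil_vec a e i $ Inr (Inl l) = e $ l"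
  "foil_vec a e i $ Inr (Inr q) = i"
  by (simp_all add: foil_vec_def)

lemma foil_vec_parts [simp]:
  "a_part (foil_vec a e i) = a" "e_part (foil_vec a e i) = e" "i_part (foil_vec a e i) = i"
  by (simp_all add: a_part_def e_part_def i_part_def)

lemma foil_vec_eq_iff: "z = z' \<longleftrightarrow> a_part z = a_part z' \<and> e_part z = e_part z' \<and> i_part z = i_part z'"
  by (auto simp: vec_eq_iff a_part_def e_part_def i_part_def split_sum_all)

lemma linear_parts: "linear a_part" "linear e_part" "linear i_part"
  by (auto intro!: linearI simp: a_part_def e_part_def i_part_def vec_eq_iff)

lemmas part_simps [simp] =
  linear_parts(1)[THEN linear_add] linear_parts(2)[THEN linear_add] linear_parts(3)[THEN linear_add]
  linear_parts(1)[THEN linear_scale] linear_parts(2)[THEN linear_scale]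
  linear_parts(3)[THEN linear_scale]

lemma inner_parts: "y \<bullet> z = a_part y \<bullet> a_part z + e_part y \<bullet> e_part z + i_part y * i_part z"
proof -
  have "sum f UNIV = (\<Sum>i\<in>UNIV. f (Inl i)) + ((\<Sum>k\<in>UNIV. f (Inr (Inl k))) + f (Inr (Inr ())))"
    for f :: "'a + 'b + unit \<Rightarrow> real"
    by (simp add: UNIV_Plus_UNIV[symmetric] sum.Plus o_def UNIV_unit del: UNIV_Plus_UNIV)
  then show ?thesis
    by (simp add: inner_vec_def a_part_def e_part_def i_part_def)
qed

section \<open>The structured form of the algebraic model\<close>

text \<open>\<open>J\<close> is the skew part of \<open>A\<close> and \<open>R\<close> is minus its
  symmetric part. A skew matrix has zero quadratic form, so that of \<open>R\<close> is minus that
  of \<open>A\<close>.\<close>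

lemma matrix_split_skew_psd:
  fixes A :: "real^'k^'k"
  assumes "\<And>y. y \<bullet> (A *v y) \<le> 0"
  obtains J R where "A = J - R" "J = - transpose J" "R = transpose R" "pos_semidef R"
proof -
  define J where "J = (1/2) *\<^sub>R (A - transpose A)"
  define R where "R = (- 1/2) *\<^sub>R (A + transpose A)"
  have "A = J - R" "J = - transpose J" "R = transpose R"
    by (auto simp: J_def R_def vec_eq_iff transpose_def field_simps)
  moreover have "y \<bullet> (R *v y) = - (y \<bullet> (A *v y))" for y
    unfolding R_def scaleR_matrix_vector_assoc[symmetric] matrix_vector_mult_add_rdistrib
    by (simp add: inner_right_distrib inner_transpose_mult_self del: transpose_matrix_vector)
  then have "pos_semidef R"
    using assms by (simp add: pos_semidef_def)
  ultimately show thesis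
    by (rule that)
qed

text \<open>The core of the argument, free of integrals: \<open>X = M ** Y\<close> records that the
  range of \<open>X\<close> lies in that of \<open>M\<close>, and \<open>M ** P ** M = M\<close>
  then turns \<open>G\<close> into \<open>transpose Y ** M ** Y\<close>.\<close>

lemma foil_conductor_fits_structure:
  fixes M K :: "real^'nw^'nw" and X :: "real^'np^'nw" and P :: "real^'nw^'nw" and c :: "real^'np"
  assumes M: "transpose M = M" "pos_semidef M" and K: "transpose K = K"
    and X: "X = M ** Y" and P: "M ** P ** M = M" and G: "G = transpose X ** P ** X"
  shows "fits_structure t0 tf (foil_unknown_of :: 'nw + 'np + unit \<Rightarrow> foil_unknown)
           (\<lambda>z (u :: real \<Rightarrow> real^1).
              foil_conductor_model t0 tf M K X G c
                (\<lambda>t. a_part (z t)) (\<lambda>t. e_part (z t)) (\<lambda>t. i_part (z t)) (\<lambda>t. u t $ 1))"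
proof -
  \<comment> \<open>The model equations with \<open>K a\<close> alone on the left and the second one
    negated; \<open>a_part z\<close> stands for the derivative of \<open>a\<close>. The coupling by
    \<open>X\<close> is symmetric and goes to \<open>R\<close>, the coupling by \<open>c\<close> is
    skew and goes to \<open>J\<close>.\<close>
  define A :: "real^('nw + 'np + unit)^('nw + 'np + unit)" where
    "A = matrix (\<lambda>z. foil_vec (X *v e_part z - M *v a_part z)
        (transpose X *v a_part z - G *v e_part z + i_part z *\<^sub>R c) (- (c \<bullet> e_part z)))"
  have A: "A *v z = foil_vec (X *v e_part z - M *v a_part z)
        (transpose X *v a_part z - G *v e_part z + i_part z *\<^sub>R c) (- (c \<bullet> e_part z))" for z
    unfolding A_def
    by (rule matrix_works, unfold linear_matrix_vector_mul_eq)
      (auto intro!: linearI simp: foil_vec_eq_iff matrix_vector_right_distrib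
        matrix_vector_mult_scaleR inner_add_right scaleR_add_left scaleR_add_right
        scaleR_diff_right simp del: transpose_matrix_vector)
  define B :: "real^1^('nw + 'np + unit)" where "B = matrix (\<lambda>u. foil_vec 0 0 (u $ 1))"
  have B: "B *v u = foil_vec 0 0 (u $ 1)" for u
    unfolding B_def
    by (rule matrix_works, unfold linear_matrix_vector_mul_eq)
      (auto intro!: linearI simp: foil_vec_eq_iff)
  have "y \<bullet> (A *v y) \<le> 0" for y
  proof -
    define a e where "a = a_part y" and "e = e_part y"
    have X_e: "X *v e = M *v (Y *v e)"
      by (simp add: X matrix_vector_mul_assoc)
    have "transpose X ** P ** X = transpose Y ** (M ** P ** M) ** Y"
      by (simp add: X matrix_transpose_mul M(1) matrix_mul_assoc)
    then have G_e: "G *v e = transpose Y *v (M *v (Y *v e))"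
      by (simp add: G P matrix_vector_mul_assoc matrix_mul_assoc del: transpose_matrix_vector)
    \<comment> \<open>The terms with \<open>c\<close> from the second and third rows cancel.\<close>
    have "y \<bullet> (A *v y) = a \<bullet> (X *v e) - a \<bullet> (M *v a) + e \<bullet> (transpose X *v a) - e \<bullet> (G *v e)"
      by (simp add: A inner_parts a_def e_def inner_right_distrib inner_diff_right inner_commute
          del: transpose_matrix_vector)
    also have "e \<bullet> (transpose X *v a) = a \<bullet> (X *v e)"
      by (simp add: inner_commute[of e] dot_lmul_matrix)
    also have "e \<bullet> (G *v e) = (Y *v e) \<bullet> (M *v (Y *v e))"
      by (simp add: G_e inner_commute[of e] dot_lmul_matrix) (simp add: inner_commute)
    \<comment> \<open>Completing the square: the two equal cross terms are \<open>a\<close> against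
      \<open>M *v (Y *v e)\<close>.\<close>
    finally have "y \<bullet> (A *v y) = - ((a - Y *v e) \<bullet> (M *v (a - Y *v e)))"
      using symmetric_inner_commute[OF M(1), of a "Y *v e"]
      by (simp add: X_e matrix_vector_mult_diff_distrib inner_diff_left inner_diff_right)
    then show ?thesis
      using M(2) by (simp add: pos_semidef_def)
  qed
  then obtain J R where JR: "A = J - R" "J = - transpose J" "R = transpose R" "pos_semidef R"
    using matrix_split_skew_psd by blast
  \<comment> \<open>The model differentiates only \<open>a\<close>; \<open>e\<close> and the current
    enter algebraically.\<close>
  define grp where "grp = (\<lambda>q. case q of Unknown_a \<Rightarrow> Z1 | Unknown_e \<Rightarrow> Z3 | Unknown_i \<Rightarrow> Z3)"
  define H where "H = (\<lambda>z :: real^('nw + 'np + unit). (1/2) * (a_part z \<bullet> (K *v a_part z)))"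
  define gradH where
    "gradH = (\<lambda>z :: real^('nw + 'np + unit). foil_vec (K *v a_part z) 0 0 :: real^('nw + 'np + unit))"
  have bl: "bounded_linear (a_part :: real^('nw + 'np + unit) \<Rightarrow> real^'nw)"
    by (simp add: linear_conv_bounded_linear[symmetric] linear_parts)
  have blK: "bounded_linear (\<lambda>z :: real^('nw + 'np + unit). K *v a_part z)"
    using bounded_linear_compose[OF matrix_vector_mul_bounded_linear bl] .
  have "GDERIV H z :> gradH z" for z
  proof -
    have "(H has_derivative (\<lambda>h. (1/2) * (a_part z \<bullet> (K *v a_part h) + a_part h \<bullet> (K *v a_part z)))) (at z)"
      unfolding H_def
      by (intro has_derivative_mult_right has_derivative_inner bounded_linear_imp_has_derivative bl blK)
    \<comment> \<open>Since \<open>K\<close> is symmetric, both terms of the product rule agree and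
      the factor 1/2 disappears.\<close>
    moreover have "(1/2) * (a_part z \<bullet> (K *v a_part h) + a_part h \<bullet> (K *v a_part z)) = h \<bullet> gradH z" for h
      unfolding symmetric_inner_commute[OF K, of "a_part z" "a_part h"]
      by (simp add: inner_parts gradH_def)
    ultimately show ?thesis
      by (simp add: gderiv_def)
  qed
  moreover have "linear gradH"
    by (auto intro!: linearI simp: gradH_def foil_vec_eq_iff
        matrix_vector_right_distrib matrix_vector_mult_scaleR)
  then have "continuous_on UNIV gradH"
    by (simp add: linear_continuous_on linear_conv_bounded_linear)
  moreover have "H z = H z'" if "\<forall>i. grp (foil_unknown_of i) \<noteq> Z3 \<longrightarrow> z $ i = z' $ i" for z z'
    using that by (simp add: H_def a_part_def grp_def split_sum_all)
  moreover have
    "foil_conductor_model t0 tf M K X G c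
        (\<lambda>t. a_part (z t)) (\<lambda>t. e_part (z t)) (\<lambda>t. i_part (z t)) (\<lambda>t. u t $ 1) \<longleftrightarrow>
     structured_system t0 tf (\<lambda>i. grp (foil_unknown_of i)) gradH J R B z u"
    for z and u :: "real \<Rightarrow> real^1"
  proof -
    let ?\<gamma> = "\<lambda>i :: 'nw + 'np + unit. grp (foil_unknown_of i)"
    have lhs: "(\<chi> i. case ?\<gamma> i of Z1 \<Rightarrow> gradH (z t) $ i | Z2 \<Rightarrow> d $ i | Z3 \<Rightarrow> 0)
        = foil_vec (K *v a_part (z t)) 0 0" for t d
      by (simp add: vec_eq_iff gradH_def grp_def split_sum_all)
    have rhs: "(\<chi> i. case ?\<gamma> i of Z1 \<Rightarrow> d $ i | Z2 \<Rightarrow> gradH (z t) $ i | Z3 \<Rightarrow> z t $ i)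
        = foil_vec (a_part d) (e_part (z t)) (i_part (z t))" for t d
      by (simp add: vec_eq_iff a_part_def e_part_def i_part_def grp_def split_sum_all)
    have der: "(\<forall>i. ?\<gamma> i \<noteq> Z3 \<longrightarrow>
          ((\<lambda>s. z s $ i) has_real_derivative d $ i) (at t within {t0..tf})) \<longleftrightarrow>
        ((\<lambda>s. a_part (z s)) has_vector_derivative a_part d) (at t within {t0..tf})" for t d
      by (simp add: has_vector_derivative_vec_iff split_sum_all a_part_def grp_def)
    have row: "foil_vec (K *v a) 0 0 = (J - R) *v foil_vec d e i + B *v u t \<longleftrightarrow>
        M *v d + K *v a - X *v e = 0 \<and> - (transpose X *v d) + G *v e - i *\<^sub>R c = 0 \<and>
        - (c \<bullet> e) + u t $ 1 = 0" for a d e i t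
      unfolding JR(1)[symmetric] A B foil_vec_eq_iff foil_vec_parts part_simps
      by (auto simp: algebra_simps eq_neg_iff_add_eq_0 simp del: transpose_matrix_vector)
    have a_part_ex: "(\<exists>da :: real \<Rightarrow> real^'nw. Q da) \<longleftrightarrow>
        (\<exists>dz :: real \<Rightarrow> real^('nw + 'np + unit). Q (\<lambda>t. a_part (dz t)))" for Q
    proof
      assume "\<exists>da. Q da"
      then obtain da where "Q da" ..
      then have "Q (\<lambda>t. a_part (foil_vec (da t) 0 0 :: real^('nw + 'np + unit)))"
        by simp
      then show "\<exists>dz :: real \<Rightarrow> real^('nw + 'np + unit). Q (\<lambda>t. a_part (dz t))"
        by (rule exI[of _ "\<lambda>t. foil_vec (da t) 0 0"])
    qed blast
    show ?thesis
      unfolding foil_conductor_model_def structured_system_def lhs rhs der row a_part_ex ..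
  qed
  ultimately show ?thesis
    unfolding fits_structure_def using JR(2-4)
    by (intro exI[of _ grp] exI[of _ H] exI[of _ gradH] exI[of _ J] exI[of _ R] exI[of _ B]) blast
qed

section \<open>Integrability and the finite element matrices\<close>

text \<open>By Cauchy-Schwarz and the inequality between the means, the sum of the squared norms is
  an integrable majorant.\<close>

lemma square_integrable_inner:
  assumes f: "square_integrable \<Omega> f" and g: "square_integrable \<Omega> g"
  shows "integrable (lebesgue_on \<Omega>) (\<lambda>x. f x \<bullet> g x)"
proof (rule Bochner_Integration.integrable_bound)
  show "integrable (lebesgue_on \<Omega>) (\<lambda>x. (norm (f x))\<^sup>2 + (norm (g x))\<^sup>2)"
    using f g by (simp add: square_integrable_def)
  show "(\<lambda>x. f x \<bullet> g x) \<in> borel_measurable (lebesgue_on \<Omega>)"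
    using f g by (auto simp: square_integrable_def intro: borel_measurable_inner)
  show "AE x in lebesgue_on \<Omega>. norm (f x \<bullet> g x) \<le> norm ((norm (f x))\<^sup>2 + (norm (g x))\<^sup>2)"
  proof (rule AE_I2)
    fix x
    have "\<bar>f x \<bullet> g x\<bar> \<le> norm (f x) * norm (g x)"
      by (rule Cauchy_Schwarz_ineq2)
    also have "\<dots> \<le> (norm (f x))\<^sup>2 + (norm (g x))\<^sup>2"
      using sum_squares_bound[of "norm (f x)" "norm (g x)"]
        mult_nonneg_nonneg[OF norm_ge_zero norm_ge_zero, of "f x" "g x"]
      by linarith
    finally show "norm (f x \<bullet> g x) \<le> norm ((norm (f x))\<^sup>2 + (norm (g x))\<^sup>2)"
      by simp
  qed
qed

text \<open>The conductivity is a multiple of the indicator function of a measurable set.\<close>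

lemma integrable_conductivity_mult:
  fixes f :: "real^3 \<Rightarrow> real"
  assumes "open \<Omega>c" and "\<Omega>c \<subseteq> \<Omega>" and "\<Omega> \<in> sets lebesgue"
    and f: "integrable (lebesgue_on \<Omega>) f"
  shows "integrable (lebesgue_on \<Omega>) (\<lambda>r. conductivity \<Omega>c \<sigma>c r * f r)"
proof -
  have "\<Omega>c \<in> sets (lebesgue_on \<Omega>)"
    using assms by (auto simp: sets_restrict_space_iff intro!: lborelD)
  then have "integrable (lebesgue_on \<Omega>) (\<lambda>r. indicator \<Omega>c r *\<^sub>R f r)"
    using f by (intro integrable_mult_indicator)
  then have "integrable (lebesgue_on \<Omega>) (\<lambda>r. \<sigma>c * (indicator \<Omega>c r *\<^sub>R f r))"
    by (rule integrable_mult_right)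
  then show ?thesis
    by (rule back_subst[where P = "integrable _"]) (auto simp: conductivity_def indicator_def)
qed

lemma mass_matrix_symmetric: "transpose (mass_matrix \<Omega> \<sigma> w) = mass_matrix \<Omega> \<sigma> w"
  by (simp add: mass_matrix_def transpose_def vec_eq_iff inner_commute)

lemma stiffness_matrix_symmetric: "transpose (stiffness_matrix \<Omega> \<nu> w) = stiffness_matrix \<Omega> \<nu> w"
  by (simp add: stiffness_matrix_def transpose_def vec_eq_iff inner_commute)

text \<open>Here \<open>s y\<close> is the field with coefficient vector \<open>y\<close>; finite
  sums are exchanged with the integral. The formula yields both semi-definiteness and a description
  of the kernel of the mass matrix.\<close>

lemma mass_matrix_quadratic_form:
  fixes w :: "'nw::finite \<Rightarrow> real^3 \<Rightarrow> real^3"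
  assumes "\<And>i j. integrable (lebesgue_on \<Omega>) (\<lambda>r. \<sigma> r * (w j r \<bullet> w i r))"
  defines "s y r \<equiv> \<Sum>i\<in>UNIV. (y::real^'nw) $ i *\<^sub>R w i r"
  shows "integrable (lebesgue_on \<Omega>) (\<lambda>r. \<sigma> r * (s y r \<bullet> s y r))"
    and "y \<bullet> (mass_matrix \<Omega> \<sigma> w *v y) = (LINT r|lebesgue_on \<Omega>. \<sigma> r * (s y r \<bullet> s y r))"
proof -
  have s: "\<sigma> r * (s y r \<bullet> s y r)
      = (\<Sum>i\<in>UNIV. \<Sum>j\<in>UNIV. y $ i * (y $ j * (\<sigma> r * (w j r \<bullet> w i r))))" for r
    by (simp add: s_def inner_sum_left inner_sum_right sum_distrib_left mult_ac inner_commute)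
  show "integrable (lebesgue_on \<Omega>) (\<lambda>r. \<sigma> r * (s y r \<bullet> s y r))"
    unfolding s using assms by (intro Bochner_Integration.integrable_sum integrable_mult_right)
  show "y \<bullet> (mass_matrix \<Omega> \<sigma> w *v y) = (LINT r|lebesgue_on \<Omega>. \<sigma> r * (s y r \<bullet> s y r))"
  proof -
    have "y \<bullet> (mass_matrix \<Omega> \<sigma> w *v y)
        = (\<Sum>i\<in>UNIV. \<Sum>j\<in>UNIV. y $ i * (y $ j * (LINT r|lebesgue_on \<Omega>. \<sigma> r * (w j r \<bullet> w i r))))"
      unfolding inner_vec_def[of y]
      by (simp add: matrix_vector_mult_def mass_matrix_def sum_distrib_left mult_ac)
    also have "\<dots> = (LINT r|lebesgue_on \<Omega>. \<sigma> r * (s y r \<bullet> s y r))"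
      unfolding s using assms(1)
      by (simp add: Bochner_Integration.integral_sum Bochner_Integration.integrable_sum)
    finally show ?thesis .
  qed
qed

lemma mass_matrix_pos_semidef:
  fixes w :: "'nw::finite \<Rightarrow> real^3 \<Rightarrow> real^3"
  assumes "\<And>i j. integrable (lebesgue_on \<Omega>) (\<lambda>r. \<sigma> r * (w j r \<bullet> w i r))" and "\<And>r. 0 \<le> \<sigma> r"
  shows "pos_semidef (mass_matrix \<Omega> \<sigma> w)"
  unfolding pos_semidef_def mass_matrix_quadratic_form(2)[OF assms(1)]
  using assms(2) by simp

text \<open>A vector in the kernel of the mass matrix represents a field that vanishes wherever
  \<open>\<sigma> > 0\<close>, and the columns of the foil matrix only see the field there.\<close>

lemma foil_matrix_column_orthogonal:
  fixes w :: "'nw::finite \<Rightarrow> real^3 \<Rightarrow> real^3"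
  assumes w: "\<And>i j. integrable (lebesgue_on \<Omega>) (\<lambda>r. \<sigma> r * (w j r \<bullet> w i r))"
    and \<sigma>: "\<And>r. 0 \<le> \<sigma> r"
    and p: "\<And>l i j. integrable (lebesgue_on \<Omega>) (\<lambda>r. \<sigma> r * p l r * (w j r \<bullet> w i r))"
    and y: "mass_matrix \<Omega> \<sigma> w *v y = 0"
  shows "y \<bullet> column l (foil_matrix \<Omega> \<sigma> w p x) = 0"
proof -
  define s where "s r = (\<Sum>i\<in>UNIV. y $ i *\<^sub>R w i r)" for r
  have "(LINT r|lebesgue_on \<Omega>. \<sigma> r * (s r \<bullet> s r)) = 0"
    using mass_matrix_quadratic_form(2)[where w=w and y=y, OF w]
    unfolding y s_def inner_zero_right by (rule sym)
  then have "AE r in lebesgue_on \<Omega>. \<sigma> r * (s r \<bullet> s r) = 0"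
    by (subst (asm) integral_nonneg_eq_0_iff_AE)
      (use mass_matrix_quadratic_form(1)[where w=w and y=y, OF w] \<sigma> in \<open>auto simp only: s_def
        inner_ge_zero mult_nonneg_nonneg intro!: AE_I2\<close>)
  \<comment> \<open>At almost every point \<sigma> or the field \<open>s\<close> vanishes, and
    either one annihilates the integrand.\<close>
  then have ae: "AE r in lebesgue_on \<Omega>. \<sigma> r * p l r * (w j r \<bullet> s r) = 0" for j
    by eventually_elim auto
  have "(\<Sum>i\<in>UNIV. y $ i * (LINT r|lebesgue_on \<Omega>. \<sigma> r * p l r * (w j r \<bullet> w i r))) = 0" for j
  proof -
    have "(\<Sum>i\<in>UNIV. y $ i * (LINT r|lebesgue_on \<Omega>. \<sigma> r * p l r * (w j r \<bullet> w i r)))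
        = (LINT r|lebesgue_on \<Omega>. (\<Sum>i\<in>UNIV. y $ i * (\<sigma> r * p l r * (w j r \<bullet> w i r))))"
      using p by (simp add: Bochner_Integration.integral_sum)
    also have "\<dots> = (LINT r|lebesgue_on \<Omega>. \<sigma> r * p l r * (w j r \<bullet> s r))"
      by (simp add: s_def inner_sum_right sum_distrib_left mult_ac)
    also have "\<dots> = 0"
      using ae by (rule integral_eq_zero_AE)
    finally show ?thesis .
  qed
  \<comment> \<open>Weighting by the coordinates of \<open>x\<close> and swapping the sums recovers
    the column of the foil matrix.\<close>
  then have "(\<Sum>j\<in>UNIV. x $ j *
      (\<Sum>i\<in>UNIV. y $ i * (LINT r|lebesgue_on \<Omega>. \<sigma> r * p l r * (w j r \<bullet> w i r)))) = 0"
    by simp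
  then show ?thesis
    unfolding sum_distrib_left
    by (subst (asm) sum.swap)
      (simp add: inner_vec_def column_def foil_matrix_def sum_distrib_left mult_ac)
qed

theorem theorem14:
  fixes \<Omega> \<Omega>c \<Omega>foil :: "(real^3) set"
    and w :: "'nw::finite \<Rightarrow> real^3 \<Rightarrow> real^3"
    and p :: "'np::finite \<Rightarrow> real^3 \<Rightarrow> real"
    and chi_sol :: "real^3 \<Rightarrow> real^3"
    and x :: "real^'nw"
    and \<Lambda> :: "real \<Rightarrow> real^3"
    and \<nu> \<sigma>c b t0 tf :: real
    and \<sigma> :: "real^3 \<Rightarrow> real"
    and M K :: "real^'nw^'nw" and X :: "real^'np^'nw" and G :: "real^'np^'np" and c :: "real^'np"
  assumes "lipschitz_domain \<Omega>" and "simply_connected \<Omega>"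
    and "open \<Omega>c" and "\<Omega>c \<subseteq> \<Omega>"
    and "open \<Omega>foil" and "\<Omega>foil \<noteq> {}" and "\<Omega>foil \<subseteq> \<Omega>c"
    and "\<nu> > 0" and "\<sigma>c > 0" and "b > 0" and "t0 < tf"
    and "\<sigma> = conductivity \<Omega>c \<sigma>c"
    and "\<forall>i. w i \<in> Hcurl \<Omega> \<and> vanishing_tangential_trace \<Omega> (w i)"
    and "lin_indep_family \<Omega> w"
    and "lin_indep_family \<Omega> p"
    and "AE r in lebesgue_on \<Omega>. chi_sol r = (\<Sum>j\<in>UNIV. x $ j *\<^sub>R w j r)"
    and "arc \<Lambda>" and "valid_path \<Lambda>" and "path_image \<Lambda> \<inter> \<Omega>foil \<noteq> {}"
    and "\<forall>l i j. integrable (lebesgue_on \<Omega>) (\<lambda>r. \<sigma> r * p l r * (w j r \<bullet> w i r))"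
    and "\<forall>k. integrable (lebesgue_on {0..1})
               (\<lambda>s. p k (\<Lambda> s) * norm (vector_derivative \<Lambda> (at s)))"
    and "M = mass_matrix \<Omega> \<sigma> w"
    and "K = stiffness_matrix \<Omega> \<nu> w"
    and "regular_pencil M K"
    and "X = foil_matrix \<Omega> \<sigma> w p x"
    and "G = transpose X ** moore_penrose M ** X"
    and "c = foil_vector b \<Lambda> p"
  shows "fits_structure t0 tf (foil_unknown_of :: 'nw + 'np + unit \<Rightarrow> foil_unknown)
           (\<lambda>z (u :: real \<Rightarrow> real^1).
              foil_conductor_model t0 tf M K X G c
                (\<lambda>t. a_part (z t)) (\<lambda>t. e_part (z t)) (\<lambda>t. i_part (z t)) (\<lambda>t. u t $ 1))"
proof -
  have \<Omega>: "\<Omega> \<in> sets lebesgue"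
    using assms(1) by (auto simp: lipschitz_domain_def intro!: lborelD)
  have \<sigma>: "0 \<le> \<sigma> r" for r
    using \<open>\<sigma>c > 0\<close> by (simp add: \<open>\<sigma> = _\<close> conductivity_def)
  have w: "integrable (lebesgue_on \<Omega>) (\<lambda>r. \<sigma> r * (w j r \<bullet> w i r))" for i j
    unfolding \<open>\<sigma> = _\<close> using assms(13) \<Omega> \<open>open \<Omega>c\<close> \<open>\<Omega>c \<subseteq> \<Omega>\<close>
    by (intro integrable_conductivity_mult square_integrable_inner) (auto simp: Hcurl_def)
  have M_sym: "transpose M = M"
    by (simp add: \<open>M = _\<close> mass_matrix_symmetric)
  \<comment> \<open>By symmetry \<open>y\<close> is in the kernel of \<open>M\<close> itself; the
    orthogonality gives the factor \<open>Y\<close> through the Fredholm alternative.\<close>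
  have "y \<bullet> column l X = 0" if "transpose M *v y = 0" for y l
  proof -
    have "mass_matrix \<Omega> \<sigma> w *v y = 0"
      using that M_sym \<open>M = _\<close> by metis
    then show ?thesis
      unfolding \<open>X = _\<close>
      using foil_matrix_column_orthogonal[where w=w, OF w \<sigma>] assms(20) by blast
  qed
  then obtain Y where "X = M ** Y"
    using matrix_factor_through by metis
  moreover have "M ** moore_penrose M ** M = M"
    using moore_penrose_symmetric[OF M_sym] by (simp add: is_moore_penrose_def)
  moreover have "pos_semidef M"
    unfolding \<open>M = _\<close> by (intro mass_matrix_pos_semidef w \<sigma>)
  moreover have "transpose K = K"
    by (simp add: \<open>K = _\<close> stiffness_matrix_symmetric)
  ultimately show ?thesis
    using M_sym assms(26) by (intro foil_conductor_fits_structure)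
qed

end
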